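(* For every $n\ge 1$, the quadruple of statistics $(\mathsf{asc},\mathsf{zero},\mathsf{max},\mathsf{Rmin})$ has the same distribution as the quadruple $(\mathsf{dist},\mathsf{zero},\mathsf{max},\mathsf{Rmin})$ on the set $\mathcal{I}_n$ of inversion sequences of length $n$.
   Context: An inversion sequence of length $n$ is a sequence $s=(s_1,\dots,s_n)$ of non-negative integers with $0\le s_i<i$ for all $i$; $\mathcal{I}_n$ is the set of all of them. For $s\in\mathcal{I}_n$: $\mathsf{asc}(s)=|\{i\in[n-1]:s_i<s_{i+1}\}|$; $\mathsf{dist}(s)=|\{s_1,\dots,s_n\}|-1$ (number of distinct non-zero entries); $\mathsf{zero}(s)=|\{i\in[n]:s_i=0\}|$; $\mathsf{max}(s)=|\{i\in[n]:s_i=i-1\}|$; and $\mathsf{Rmin}(s)=\{s_i:s_i<s_j\text{ for all }j>i\}$ is the set-valued statistic of right-to-left minima. Same distribution means that each tuple of values (the last component being a set) is attained by the same number of elements of $\mathcal{I}_n$. *)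

theory Defs
  imports Main
begin

text \<open>
  A sequence \<open>(s\<^sub>1, \<dots>, s\<^sub>n)\<close> is the list \<open>s\<close> with \<open>s ! i = s\<^sub>i\<^sub>+\<^sub>1\<close>. With this shift of
  indices the condition \<open>s\<^sub>i < i\<close> becomes \<open>s ! i < i + 1\<close>, and \<open>s\<^sub>i = i - 1\<close> becomes \<open>s ! i = i\<close>.
\<close>

definition inv_seqs :: "nat \<Rightarrow> nat list set" where
  "inv_seqs n = {s. length s = n \<and> (\<forall>i<n. s ! i < i + 1)}"

definition num_asc :: "nat list \<Rightarrow> nat" where
  "num_asc s = card {i. i + 1 < length s \<and> s ! i < s ! (i + 1)}"

text \<open>
  The natural subtraction below does not truncate on nonempty sequences. A nonempty inversion
  sequence contains \<open>0\<close>, so the value is its number of distinct nonzero entries.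
\<close>

definition num_dist :: "nat list \<Rightarrow> nat" where
  "num_dist s = card (set s) - 1"

definition num_zero :: "nat list \<Rightarrow> nat" where
  "num_zero s = card {i. i < length s \<and> s ! i = 0}"

definition num_max :: "nat list \<Rightarrow> nat" where
  "num_max s = card {i. i < length s \<and> s ! i = i}"

definition Rmin :: "nat list \<Rightarrow> nat set" where
  "Rmin s = {s ! i |i. i < length s \<and> (\<forall>j. i < j \<and> j < length s \<longrightarrow> s ! i < s ! j)}"

text \<open>Since \<open>inv_seqs n\<close> is finite, counting its elements by \<open>card\<close> is meaningful.\<close>

lemma finite_inv_seqs: "finite (inv_seqs n)"
proof (rule finite_subset)
  show "inv_seqs n \<subseteq> {s. set s \<subseteq> {..n} \<and> length s = n}"
    by (fastforce simp: inv_seqs_def in_set_conv_nth)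
  show "finite {s. set s \<subseteq> {..n} \<and> length s = n}"
    by (rule finite_lists_length_eq) simp
qed

end

theory Submission
  imports Defs "HOL-Library.Multiset"
begin

text \<open>
  Append a last entry \<open>v \<le> n\<close> to \<open>s \<in> inv_seqs n\<close>. The statistics \<open>num_zero\<close> and \<open>num_max\<close> grow by
  amounts depending only on \<open>v\<close> and \<open>n\<close>, and \<open>Rmin\<close> becomes \<open>(Rmin s \<inter> {..<v}) \<union> {v}\<close>.
  But \<open>num_asc\<close> grows exactly if \<open>last s < v\<close>, whereas \<open>num_dist\<close> grows exactly if \<open>v \<notin> set s\<close>.
  Since \<open>last s\<close> is the maximum of \<open>Rmin s\<close>, the induction on \<open>n\<close> goes through once we have, for
  each \<open>v\<close>, a permutation of \<open>inv_seqs n\<close> that turns the condition \<open>last s < v\<close> into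
  \<open>v \<notin> set s\<close> and preserves \<open>num_dist\<close>, \<open>num_zero\<close>, \<open>num_max\<close> and \<open>Rmin s \<inter> {..<v}\<close>.
  Such a permutation exists because the sequences with \<open>v \<notin> set s\<close> and those with \<open>last s < v\<close>
  correspond: every entry \<open>x > v\<close> is lowered by one and moved one place to the left, while the
  entries \<open>x < v\<close> fill the remaining places in their old order.
\<close>

section \<open>Equidistributed statistics\<close>

text \<open>Bijections chosen separately between the fibres over each value glue together, because
  the fibres partition \<open>A\<close> and \<open>B\<close>.\<close>

lemma bij_betw_if_equidistributed:
  assumes "finite A" "finite B"
    and card_eq: "\<And>c. card {a \<in> A. \<phi> a = c} = card {b \<in> B. \<psi> b = c}"
  obtains g where "bij_betw g A B" "\<And>a. a \<in> A \<Longrightarrow> \<psi> (g a) = \<phi> a"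
proof -
  have "\<exists>h. bij_betw h {a \<in> A. \<phi> a = c} {b \<in> B. \<psi> b = c}" for c
    using assms by (intro finite_same_card_bij) auto
  then obtain H where H: "\<And>c. bij_betw (H c) {a \<in> A. \<phi> a = c} {b \<in> B. \<psi> b = c}"
    by metis
  define g where "g a = H (\<phi> a) a" for a
  have g: "g a \<in> B \<and> \<psi> (g a) = \<phi> a" if "a \<in> A" for a
    using bij_betwE[OF H[of "\<phi> a"]] that by (auto simp: g_def)
  have "inj_on g A"
  proof (rule inj_onI)
    fix a b assume ab: "a \<in> A" "b \<in> A" "g a = g b"
    then have "\<phi> a = \<phi> b" using g by metis
    then show "a = b"
      using ab bij_betw_imp_inj_on[OF H[of "\<phi> b"]] by (auto simp: g_def inj_on_def)
  qed
  moreover have "g ` A = B"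
  proof
    show "g ` A \<subseteq> B" using g by auto
    show "B \<subseteq> g ` A"
    proof
      fix b assume "b \<in> B"
      then have "b \<in> H (\<psi> b) ` {a \<in> A. \<phi> a = \<psi> b}"
        using bij_betw_imp_surj_on[OF H[of "\<psi> b"]] by auto
      then show "b \<in> g ` A" unfolding g_def by force
    qed
  qed
  ultimately show thesis using that g by (auto simp: bij_betw_def)
qed

lemma bij_betw_stat_card_eq:
  assumes "bij_betw h A B" "\<And>a. a \<in> A \<Longrightarrow> \<psi> (h a) = \<phi> a"
  shows "card {a \<in> A. \<phi> a = c} = card {b \<in> B. \<psi> b = c}"
proof (rule bij_betw_same_card)
  show "bij_betw h {a \<in> A. \<phi> a = c} {b \<in> B. \<psi> b = c}"
    using assms by (auto simp: bij_betw_def inj_on_def)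
qed

text \<open>In each fibre of \<open>\<phi>\<close> the map \<open>h\<close> matches the elements
  satisfying \<open>P\<close> with those satisfying \<open>Q\<close>; by finiteness the complements
  have equal size too. So the pairs (\<open>\<phi>\<close>, \<open>P\<close>) and
  (\<open>\<phi>\<close>, \<open>Q\<close>) are equidistributed on \<open>S\<close>.\<close>

lemma bij_betw_extend_preserving:
  assumes "finite S" and h: "bij_betw h {s \<in> S. P s} {s \<in> S. Q s}"
    and stat: "\<And>s. s \<in> S \<Longrightarrow> P s \<Longrightarrow> \<phi> (h s) = \<phi> s"
  obtains g where "bij_betw g S S" "\<And>s. s \<in> S \<Longrightarrow> \<phi> (g s) = \<phi> s"
    "\<And>s. s \<in> S \<Longrightarrow> Q (g s) \<longleftrightarrow> P s"
proof -
  have pos: "card {s \<in> S. P s \<and> \<phi> s = c} = card {s \<in> S. Q s \<and> \<phi> s = c}" for c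
    using bij_betw_stat_card_eq[OF h, of \<phi> \<phi> c] stat by (auto simp: conj_assoc)
  have split: "card {s \<in> S. \<phi> s = c} = card {s \<in> S. R s \<and> \<phi> s = c} + card {s \<in> S. \<not> R s \<and> \<phi> s = c}"
    for R c
    using \<open>finite S\<close> by (subst card_Un_disjoint[symmetric]) (auto intro: arg_cong[of _ _ card])
  have neg: "card {s \<in> S. \<not> P s \<and> \<phi> s = c} = card {s \<in> S. \<not> Q s \<and> \<phi> s = c}" for c
    using split[of c P] split[of c Q] pos[of c] by simp
  have "card {s \<in> S. (\<phi> s, P s) = c} = card {s \<in> S. (\<phi> s, Q s) = c}" for c
    using pos[of "fst c"] neg[of "fst c"]
    by (cases c; cases "snd c") (auto simp: conj_commute)
  then obtain g where "bij_betw g S S" "\<And>s. s \<in> S \<Longrightarrow> (\<phi> (g s), Q (g s)) = (\<phi> s, P s)"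
    using bij_betw_if_equidistributed[OF \<open>finite S\<close> \<open>finite S\<close>, of "\<lambda>s. (\<phi> s, P s)" "\<lambda>s. (\<phi> s, Q s)"]
    by metis
  then show thesis using that by simp
qed

section \<open>Statistics of lists\<close>

lemma num_zero_eq_count: "num_zero s = count (mset s) 0"
  unfolding num_zero_def count_mset count_list_eq_length_filter length_filter_conv_card
  by (simp add: eq_commute[of 0])

lemma num_zero_snoc: "num_zero (s @ [v]) = num_zero s + of_bool (v = 0)"
  by (simp add: num_zero_eq_count)

lemma num_asc_snoc:
  assumes "s \<noteq> []"
  shows "num_asc (s @ [v]) = num_asc s + of_bool (last s < v)"
proof -
  have "{i. i + 1 < length (s @ [v]) \<and> (s @ [v]) ! i < (s @ [v]) ! (i + 1)} =
      {i. i + 1 < length s \<and> s ! i < s ! (i + 1)} \<union>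
      (if last s < v then {length s - 1} else {})" (is "?L = ?A \<union> ?B")
    using assms by (cases s rule: rev_cases) (auto simp: nth_append less_Suc_eq)
  moreover have "finite ?A" by (rule finite_subset[of _ "{..<length s}"]) auto
  moreover have "?A \<inter> ?B = {}" by auto
  ultimately show ?thesis
    unfolding num_asc_def by (simp add: card_Un_disjoint split: if_splits)
qed

lemma num_dist_snoc:
  assumes "s \<noteq> []"
  shows "num_dist (s @ [v]) = num_dist s + of_bool (v \<notin> set s)"
  using assms by (cases "card (set s)") (auto simp: num_dist_def insert_absorb)

text \<open>The offset \<open>k\<close> is the place of the head within a longer sequence. It makes
  recursion on the tail possible, as it does in \<open>inv_from\<close>.\<close>

definition num_diag :: "nat \<Rightarrow> nat list \<Rightarrow> nat" where
  "num_diag k s = card {i. i < length s \<and> s ! i = k + i}"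

lemma num_max_eq_num_diag: "num_max s = num_diag 0 s"
  by (simp add: num_max_def num_diag_def)

lemma num_diag_Nil [simp]: "num_diag k [] = 0"
  by (simp add: num_diag_def)

lemma num_diag_Cons [simp]: "num_diag k (x # xs) = of_bool (x = k) + num_diag (Suc k) xs"
proof -
  have eq: "{i. i < length (x # xs) \<and> (x # xs) ! i = k + i} =
      (if x = k then {0} else {}) \<union> Suc ` {i. i < length xs \<and> xs ! i = Suc k + i}"
    by (auto simp: less_Suc_eq_0_disj)
  show ?thesis
    unfolding num_diag_def eq by (subst card_Un_disjoint) (auto simp: card_image)
qed

lemma num_diag_snoc: "num_diag k (s @ [v]) = num_diag k s + of_bool (v = k + length s)"
  by (induction s arbitrary: k) auto

lemma Rmin_Nil [simp]: "Rmin [] = {}"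
  by (simp add: Rmin_def)

lemma Rmin_Cons [simp]:
  "Rmin (x # xs) = (if \<forall>y\<in>set xs. x < y then {x} else {}) \<union> Rmin xs"
proof -
  have 1: "y \<in> Rmin (x # xs) \<longleftrightarrow> (\<exists>i<length (x # xs). y = (x # xs) ! i \<and>
      (\<forall>j<length (x # xs). i < j \<longrightarrow> (x # xs) ! i < (x # xs) ! j))" for y
    by (auto simp: Rmin_def)
  have 2: "y \<in> Rmin xs \<longleftrightarrow> (\<exists>i<length xs. y = xs ! i \<and>
      (\<forall>j<length xs. i < j \<longrightarrow> xs ! i < xs ! j))" for y
    by (auto simp: Rmin_def)
  show ?thesis
    by (rule set_eqI) (auto simp: 1 2 Ex_less_Suc2 All_less_Suc2 all_set_conv_all_nth)
qed

lemma Rmin_snoc: "Rmin (s @ [v]) = insert v (Rmin s \<inter> {..<v})"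
  by (induction s) auto

text \<open>An entry \<ge> \<open>v\<close> never prevents one below \<open>v\<close> from being a
  right-to-left minimum, so only the subword of entries below \<open>v\<close> matters, and
  \<open>pull\<close> keeps that subword.\<close>

lemma Rmin_Int_lessThan: "Rmin s \<inter> {..<v} = Rmin (filter (\<lambda>x. x < v) s)"
proof (induction s)
  case (Cons x xs)
  have "(\<forall>y\<in>set xs. x < y) \<longleftrightarrow> (\<forall>y\<in>set (filter (\<lambda>x. x < v) xs). x < y)" if "x < v"
    using that by auto
  with Cons show ?case by auto
qed simp

lemma last_in_Rmin: "s \<noteq> [] \<Longrightarrow> last s \<in> Rmin s"
  by (induction s) auto

lemma Rmin_le_last: "x \<in> Rmin s \<Longrightarrow> x \<le> last s"
  by (induction s) (auto split: if_splits simp: less_imp_le)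

lemma last_less_iff_Rmin: "s \<noteq> [] \<Longrightarrow> last s < v \<longleftrightarrow> (\<forall>x\<in>Rmin s. x < v)"
  using last_in_Rmin Rmin_le_last by (meson le_less_trans)

section \<open>Inversion sequences\<close>

definition inv_from :: "nat \<Rightarrow> nat list \<Rightarrow> bool" where
  "inv_from k s \<longleftrightarrow> (\<forall>i<length s. s ! i \<le> k + i)"

lemma inv_from_Nil [simp]: "inv_from k []"
  by (simp add: inv_from_def)

lemma inv_from_Cons [simp]: "inv_from k (x # xs) \<longleftrightarrow> x \<le> k \<and> inv_from (Suc k) xs"
  by (auto simp: inv_from_def All_less_Suc2)

lemma inv_from_snoc: "inv_from k (s @ [v]) \<longleftrightarrow> inv_from k s \<and> v \<le> k + length s"
  by (induction s arbitrary: k) auto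

lemma inv_seqs_eq: "inv_seqs n = {s. length s = n \<and> inv_from 0 s}"
  by (auto simp: inv_seqs_def inv_from_def less_Suc_eq_le)

lemma inv_seqs_Suc: "s \<in> inv_seqs (Suc n) \<longleftrightarrow> (\<exists>t v. s = t @ [v] \<and> t \<in> inv_seqs n \<and> v \<le> n)"
  by (cases s rule: rev_cases) (auto simp: inv_seqs_eq inv_from_snoc)

section \<open>Moving the large entries\<close>

text \<open>
  The list \<open>c # xs\<close> is scanned with the last entry below \<open>v\<close>, initially \<open>c\<close>, held back: each
  entry above \<open>v\<close> overtakes it, so moves one place to the left.
\<close>

fun pull :: "nat \<Rightarrow> nat \<Rightarrow> nat list \<Rightarrow> nat list" where
  "pull v c [] = [c]"
| "pull v c (x # xs) = (if v < x then (x - 1) # pull v c xs else c # pull v x xs)"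

fun pull_list :: "nat \<Rightarrow> nat list \<Rightarrow> nat list" where
  "pull_list v [] = []"
| "pull_list v (c # xs) = pull v c xs"

text \<open>Undoes \<open>pull\<close> from right to left. The head of the result is the entry held
  back at that point: some \<open>y < v\<close> replaces it, whereas some \<open>y\<close> \<ge>
  \<open>v\<close> is raised again and passes behind it.\<close>

fun push :: "nat \<Rightarrow> nat list \<Rightarrow> nat list" where
  "push v [] = []"
| "push v (y # ys) = (case push v ys of [] \<Rightarrow> [y]
     | c # zs \<Rightarrow> if y < v then y # c # zs else c # Suc y # zs)"

lemma length_pull [simp]: "length (pull v c xs) = Suc (length xs)"
  by (induction v c xs rule: pull.induct) auto

lemma pull_not_Nil [simp]: "pull v c xs \<noteq> []"
  by (metis length_pull length_0_conv nat.distinct(1))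

text \<open>An overtaking entry loses one place but also one unit, and a held entry only moves
  right, so both stay within their bounds.\<close>

lemma inv_from_pull: "inv_from k (c # xs) \<Longrightarrow> inv_from k (pull v c xs)"
  by (induction v c xs arbitrary: k rule: pull.induct) auto

lemma last_pull: "c < v \<Longrightarrow> v \<notin> set xs \<Longrightarrow> last (pull v c xs) < v"
  by (induction v c xs rule: pull.induct) auto

lemma mset_pull:
  "c < v \<Longrightarrow> v \<notin> set xs \<Longrightarrow>
    mset (pull v c xs) = image_mset (\<lambda>x. if v < x then x - 1 else x) (mset (c # xs))"
  by (induction v c xs rule: pull.induct) auto

lemma filter_pull:
  "c < v \<Longrightarrow> v \<notin> set xs \<Longrightarrow>
    filter (\<lambda>x. x < v) (pull v c xs) = filter (\<lambda>x. x < v) (c # xs)"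
  by (induction v c xs rule: pull.induct) auto

text \<open>An entry below \<open>v\<close> overtaken by some \<open>x > v\<close> is at a place \<open>\<ge> v\<close>, so off the diagonal before and after.\<close>

lemma num_diag_pull:
  "c < v \<Longrightarrow> v \<notin> set xs \<Longrightarrow> inv_from k (c # xs) \<Longrightarrow> num_diag k (pull v c xs) = num_diag k (c # xs)"
  by (induction v c xs arbitrary: k rule: pull.induct) auto

lemma push_pull: "c < v \<Longrightarrow> v \<notin> set xs \<Longrightarrow> push v (pull v c xs) = c # xs"
  by (induction v c xs rule: pull.induct) auto

text \<open>The last entry, being below \<open>v\<close>, is the first one held. Raised entries
  exceed \<open>v\<close>, and moving \<open>c\<close> one place left past \<open>y\<close> respects
  the bound because \<open>c < v \<le> y\<close>.\<close>

lemma push_props: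
  assumes "s \<noteq> []" "last s < v"
  shows "\<exists>c xs. push v s = c # xs \<and> length xs + 1 = length s \<and> c < v \<and> v \<notin> set xs \<and>
    pull v c xs = s \<and> (\<forall>k. inv_from k s \<longrightarrow> inv_from k (c # xs))"
  using assms
proof (induction s)
  case (Cons y ys)
  show ?case
  proof (cases "ys = []")
    case False
    with Cons obtain c xs where
      "push v ys = c # xs" "length xs + 1 = length ys" "c < v" "v \<notin> set xs"
      "pull v c xs = ys" "\<And>k. inv_from k ys \<Longrightarrow> inv_from k (c # xs)"
      by auto
    then show ?thesis by (cases "y < v") auto
  qed (use Cons in auto)
qed simp

lemma bij_betw_pull_list:
  assumes "n \<ge> 1" "v \<ge> 1"
  shows "bij_betw (pull_list v) {s \<in> inv_seqs n. v \<notin> set s} {s \<in> inv_seqs n. last s < v}"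
proof (rule bij_betw_byWitness[where f' = "push v"])
  \<comment> \<open>The initial entry 0 lies below \<open>v\<close>, so it is a valid first entry to
    hold back.\<close>
  have Cons: "\<exists>xs. s = 0 # xs" if "s \<in> inv_seqs n" for s
    using that assms by (cases s) (auto simp: inv_seqs_eq)
  have nonempty: "s \<noteq> []" if "s \<in> inv_seqs n" for s
    using Cons[OF that] by auto
  show "\<forall>s\<in>{s \<in> inv_seqs n. v \<notin> set s}. push v (pull_list v s) = s"
  proof clarify
    fix s assume s: "s \<in> inv_seqs n" "v \<notin> set s"
    then obtain xs where "s = 0 # xs" using Cons by blast
    with s assms show "push v (pull_list v s) = s" by (simp add: push_pull)
  qed
  show "\<forall>s\<in>{s \<in> inv_seqs n. last s < v}. pull_list v (push v s) = s"
  proof clarify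
    fix s assume s: "s \<in> inv_seqs n" "last s < v"
    with push_props[OF nonempty[OF s(1)] s(2)] show "pull_list v (push v s) = s" by auto
  qed
  show "pull_list v ` {s \<in> inv_seqs n. v \<notin> set s} \<subseteq> {s \<in> inv_seqs n. last s < v}"
  proof clarify
    fix s assume s: "s \<in> inv_seqs n" "v \<notin> set s"
    then obtain xs where "s = 0 # xs" using Cons by blast
    with s assms show "pull_list v s \<in> inv_seqs n \<and> last (pull_list v s) < v"
      by (auto simp: inv_seqs_eq inv_from_pull last_pull)
  qed
  show "push v ` {s \<in> inv_seqs n. last s < v} \<subseteq> {s \<in> inv_seqs n. v \<notin> set s}"
  proof clarify
    fix s assume s: "s \<in> inv_seqs n" "last s < v"
    obtain c xs where "push v s = c # xs" "length xs + 1 = length s" "c < v" "v \<notin> set xs"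
      "inv_from 0 s \<Longrightarrow> inv_from 0 (c # xs)"
      using push_props[OF nonempty[OF s(1)] s(2)] by blast
    with s show "push v s \<in> inv_seqs n \<and> v \<notin> set (push v s)"
      by (simp add: inv_seqs_eq)
  qed
qed

lemma pull_list_preserves:
  assumes "s \<in> inv_seqs n" "v \<notin> set s" "n \<ge> 1" "v \<ge> 1"
  shows "num_dist (pull_list v s) = num_dist s" "num_zero (pull_list v s) = num_zero s"
    "num_max (pull_list v s) = num_max s" "Rmin (pull_list v s) \<inter> {..<v} = Rmin s \<inter> {..<v}"
proof -
  obtain xs where s: "s = 0 # xs"
    using assms by (cases s) (auto simp: inv_seqs_eq)
  let ?d = "\<lambda>x::nat. if v < x then x - 1 else x"
  have mset: "mset (pull_list v s) = image_mset ?d (mset s)"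
    using assms mset_pull[of 0 v xs] s by simp
  then have "set (pull_list v s) = ?d ` set s"
    by (metis set_image_mset set_mset_mset)
  \<comment> \<open>The only values that \<open>?d\<close> identifies are \<open>v\<close> and
    \<open>v + 1\<close>, and \<open>v\<close> does not occur in \<open>s\<close>.\<close>
  moreover have "inj_on ?d (set s)"
  proof (rule inj_onI)
    fix x y assume "x \<in> set s" "y \<in> set s" and eq: "?d x = ?d y"
    then have "x \<noteq> v" "y \<noteq> v" using assms(2) by auto
    with eq show "x = y" by (auto split: if_splits)
  qed
  ultimately show "num_dist (pull_list v s) = num_dist s"
    by (simp only: num_dist_def card_image)
  \<comment> \<open>A lowered entry is still at least \<open>v \<ge> 1\<close>, so no new zero
    arises.\<close>
  have "?d -` {0} = {0}" using assms(4) by (auto split: if_splits)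
  then show "num_zero (pull_list v s) = num_zero s"
    by (simp add: num_zero_eq_count mset count_image_mset Int_insert_left count_mset_0_iff)
  show "num_max (pull_list v s) = num_max s"
    using assms num_diag_pull[of 0 v xs 0] s
    by (auto simp: num_max_eq_num_diag inv_seqs_eq simp del: num_diag_Cons)
  show "Rmin (pull_list v s) \<inter> {..<v} = Rmin s \<inter> {..<v}"
    using assms s filter_pull[of 0 v xs] by (simp add: Rmin_Int_lessThan del: Rmin_Cons)
qed

lemma exchange_last_less_and_not_in:
  assumes "n \<ge> 1"
  obtains g where "bij_betw g (inv_seqs n) (inv_seqs n)"
    "\<And>s. s \<in> inv_seqs n \<Longrightarrow> num_dist (g s) = num_dist s \<and> num_zero (g s) = num_zero s \<and>
      num_max (g s) = num_max s \<and> Rmin (g s) \<inter> {..<v} = Rmin s \<inter> {..<v} \<and>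
      (v \<notin> set (g s) \<longleftrightarrow> last s < v)"
proof (cases "v = 0")
  case True
  \<comment> \<open>For \<open>v = 0\<close> both conditions fail on every sequence, so the identity
    works.\<close>
  have "0 \<in> set s" if "s \<in> inv_seqs n" for s
    using that assms by (cases s) (auto simp: inv_seqs_eq)
  with True show thesis by (intro that[of id]) auto
next
  case False
  then have v: "v \<ge> 1" by simp
  let ?\<phi> = "\<lambda>s. (num_dist s, num_zero s, num_max s, Rmin s \<inter> {..<v})"
  \<comment> \<open>The inverse of \<open>pull_list\<close> is the direction that turns
    \<open>last s < v\<close> into \<open>v \<notin> set s\<close>.\<close>
  have "bij_betw (inv_into {s \<in> inv_seqs n. v \<notin> set s} (pull_list v))
      {s \<in> inv_seqs n. last s < v} {s \<in> inv_seqs n. v \<notin> set s}" (is "bij_betw ?h ?P ?Q")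
    using bij_betw_pull_list[OF assms v] by (rule bij_betw_inv_into)
  moreover have "?\<phi> (?h s) = ?\<phi> s" if "s \<in> inv_seqs n" "last s < v" for s
  proof -
    have "?h s \<in> ?Q" using bij_betwE[OF calculation] that by blast
    moreover have "pull_list v (?h s) = s"
      using that bij_betw_inv_into_right[OF bij_betw_pull_list[OF assms v]] by blast
    ultimately show ?thesis
      using pull_list_preserves[of "?h s" n v] assms v by auto
  qed
  ultimately obtain g where "bij_betw g (inv_seqs n) (inv_seqs n)"
    "\<And>s. s \<in> inv_seqs n \<Longrightarrow> ?\<phi> (g s) = ?\<phi> s"
    "\<And>s. s \<in> inv_seqs n \<Longrightarrow> v \<notin> set (g s) \<longleftrightarrow> last s < v"
    by (rule bij_betw_extend_preserving[OF finite_inv_seqs, where \<phi> = ?\<phi>]) blast+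
  then show thesis by (intro that[of g]) auto
qed

section \<open>The bijection from ascents to distinct entries\<close>

lemma bij_asc_to_dist:
  assumes "n \<ge> 1"
  shows "\<exists>f. bij_betw f (inv_seqs n) (inv_seqs n) \<and> (\<forall>s\<in>inv_seqs n.
    (num_dist (f s), num_zero (f s), num_max (f s), Rmin (f s)) =
    (num_asc s, num_zero s, num_max s, Rmin s))"
  using assms
proof (induction n rule: nat_induct_at_least)
  case base
  have "inv_seqs 1 = {[0]}"
    by (auto simp: inv_seqs_eq length_Suc_conv)
  then show ?case
    by (intro exI[of _ id]) (auto simp: num_dist_def num_asc_def)
next
  case (Suc n)
  then obtain f where f: "bij_betw f (inv_seqs n) (inv_seqs n)"
    and f_stat: "\<And>s. s \<in> inv_seqs n \<Longrightarrow> num_dist (f s) = num_asc s \<and>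
      num_zero (f s) = num_zero s \<and> num_max (f s) = num_max s \<and> Rmin (f s) = Rmin s"
    by auto
  have "\<exists>g. bij_betw g (inv_seqs n) (inv_seqs n) \<and> (\<forall>s\<in>inv_seqs n.
      num_dist (g s) = num_dist s \<and> num_zero (g s) = num_zero s \<and>
      num_max (g s) = num_max s \<and> Rmin (g s) \<inter> {..<v} = Rmin s \<inter> {..<v} \<and>
      (v \<notin> set (g s) \<longleftrightarrow> last s < v))" for v
    using exchange_last_less_and_not_in[OF Suc.hyps, of v] by metis
  then obtain g where g: "\<And>v. bij_betw (g v) (inv_seqs n) (inv_seqs n)"
    and g_stat: "\<And>v s. s \<in> inv_seqs n \<Longrightarrow> num_dist (g v s) = num_dist s \<and>
      num_zero (g v s) = num_zero s \<and> num_max (g v s) = num_max s \<and>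
      Rmin (g v s) \<inter> {..<v} = Rmin s \<inter> {..<v} \<and> (v \<notin> set (g v s) \<longleftrightarrow> last s < v)"
    by metis
  \<comment> \<open>The last entry \<open>v\<close> is kept and selects the permutation applied
    after \<open>f\<close>. Agreement of \<open>Rmin\<close> below \<open>v\<close> is enough, since
    appending \<open>v\<close> discards all other right-to-left minima.\<close>
  define F where "F s = g (last s) (f (butlast s)) @ [last s]" for s
  have F_snoc: "F (s @ [v]) = g v (f s) @ [v]" for s v by (simp add: F_def)
  have f_in: "f s \<in> inv_seqs n" and g_in: "g v s \<in> inv_seqs n" if "s \<in> inv_seqs n" for s v
    using bij_betwE[OF f] bij_betwE[OF g] that by auto
  have nonempty: "s \<noteq> []" and length: "length s = n" if "s \<in> inv_seqs n" for s
    using that \<open>n \<ge> 1\<close> by (auto simp: inv_seqs_eq)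
  have "inj_on F (inv_seqs (Suc n))"
  proof (rule inj_onI)
    fix s s' assume "s \<in> inv_seqs (Suc n)" "s' \<in> inv_seqs (Suc n)" and eq: "F s = F s'"
    then obtain t v t' v' where s: "s = t @ [v]" "s' = t' @ [v']"
      and t: "t \<in> inv_seqs n" "t' \<in> inv_seqs n"
      by (auto simp: inv_seqs_Suc)
    from eq s have "v = v'" "g v (f t) = g v (f t')" by (auto simp: F_snoc)
    with t f_in have "f t = f t'"
      by (meson bij_betw_imp_inj_on[OF g] inj_onD)
    with t have "t = t'" by (meson bij_betw_imp_inj_on[OF f] inj_onD)
    with s \<open>v = v'\<close> show "s = s'" by simp
  qed
  moreover have "F ` inv_seqs (Suc n) \<subseteq> inv_seqs (Suc n)"
  proof clarify
    fix s assume "s \<in> inv_seqs (Suc n)"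
    then obtain t v where "s = t @ [v]" "t \<in> inv_seqs n" "v \<le> n" by (auto simp: inv_seqs_Suc)
    then show "F s \<in> inv_seqs (Suc n)" using f_in g_in by (auto simp: F_snoc inv_seqs_Suc)
  qed
  ultimately have "bij_betw F (inv_seqs (Suc n)) (inv_seqs (Suc n))"
    using finite_inv_seqs by (simp add: bij_betw_def endo_inj_surj)
  moreover have "(num_dist (F s), num_zero (F s), num_max (F s), Rmin (F s)) =
      (num_asc s, num_zero s, num_max s, Rmin s)" if "s \<in> inv_seqs (Suc n)" for s
  proof -
    from that obtain t v where s: "s = t @ [v]" and t: "t \<in> inv_seqs n"
      by (auto simp: inv_seqs_Suc)
    note ft = f_in[OF t] and gft = g_in[OF f_in[OF t], of v]
    \<comment> \<open>The new ascent depends on \<open>last t\<close>, but \<open>g v\<close> is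
      applied to \<open>f t\<close>; as \<open>f\<close> preserves \<open>Rmin\<close>, the two
      comparisons with \<open>v\<close> agree.\<close>
    have "last (f t) < v \<longleftrightarrow> last t < v"
      using f_stat[OF t] nonempty[OF t] nonempty[OF ft] by (simp add: last_less_iff_Rmin)
    then show ?thesis
      using f_stat[OF t] g_stat[OF ft, of v] nonempty[OF t] nonempty[OF gft] length[OF t] length[OF gft]
      by (simp add: s F_snoc num_dist_snoc num_asc_snoc num_zero_snoc num_max_eq_num_diag
          num_diag_snoc Rmin_snoc)
  qed
  ultimately show ?case by blast
qed

theorem theorem15:
  fixes n :: nat
  assumes "n \<ge> 1"
  shows "\<forall>(a::nat) (z::nat) (m::nat) (R::nat set).
    card {s \<in> inv_seqs n. num_asc s = a \<and> num_zero s = z \<and> num_max s = m \<and> Rmin s = R} =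
    card {s \<in> inv_seqs n. num_dist s = a \<and> num_zero s = z \<and> num_max s = m \<and> Rmin s = R}"
proof (intro allI)
  fix a z m :: nat and R :: "nat set"
  obtain f where f: "bij_betw f (inv_seqs n) (inv_seqs n)"
    "\<And>s. s \<in> inv_seqs n \<Longrightarrow> (num_dist (f s), num_zero (f s), num_max (f s), Rmin (f s)) =
      (num_asc s, num_zero s, num_max s, Rmin s)"
    using bij_asc_to_dist[OF assms] by blast
  have "card {s \<in> inv_seqs n. (num_asc s, num_zero s, num_max s, Rmin s) = (a, z, m, R)} =
      card {s \<in> inv_seqs n. (num_dist s, num_zero s, num_max s, Rmin s) = (a, z, m, R)}"
    by (rule bij_betw_stat_card_eq[OF f(1)]) (rule f(2))
  then show "card {s \<in> inv_seqs n. num_asc s = a \<and> num_zero s = z \<and> num_max s = m \<and> Rmin s = R} =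
      card {s \<in> inv_seqs n. num_dist s = a \<and> num_zero s = z \<and> num_max s = m \<and> Rmin s = R}"
    by simp
qed

end
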